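(* Let $A=(a_{ij})\in\mathbb{R}^{M\times N}$ have nonnegative entries with $\sum_{i=1}^M a_{ij}=1$ for every $j$, and let $b=(b_1,\dots,b_M)^t$ with $b_i>0$ for every $i$. Let $x^0\in\mathbb{R}^N$ with $x^0_j>0$ for all $j$, let $(\beta_k)_{k\ge 0}$ be positive real numbers, let $(v^k)_{k\ge 0}$ be a bounded sequence in $\mathbb{R}^N$, and let $\{x^k\}_{k\in\mathbb{N}}$ be generated by the perturbed EM iteration $$x^{k+1}_j=y^k_j\, f_j(y^k),\qquad y^k=x^k+\beta_k v^k,\qquad j=1,\dots,N,\ k\ge 0,$$ where $f_j(y)=\sum_{i=1}^M \frac{a_{ij}b_i}{d_i(y)}$ and $d_i(y)=\sum_{t=1}^N a_{it}y_t$. Suppose that: 1. (Positivity) $y^k_j>0$ for all $j$ and all $k$. 2. (Vanishing) $\beta_k\to 0$ as $k\to\infty$. 3. (Decreasing) There are a constant $\rho>0$ and a limit $\hat x$ of a convergent subsequence $\{x^{m_k}\}$ of $\{x^k\}$ (such a subsequence exists, see conclusion 2) such that for every $k$ $$\beta_k\max_{j\in S_k^-}\Big\{-\frac{v_j^k}{y_j^k}\Big\}B_k^- \;-\;\beta_k\min_{j\in S_k^+}\Big\{\frac{v_j^k}{y_j^k}\Big\}B_k^+\;+\;\beta_k\sum_{j=1}^N v_j^k \;<\; I_A^b(y^k)-I_A^b(x^{k+1}),$$ where $S_k^-=\{j: v_j^k<0\}$, $S_k^+=\{j: v_j^k>0\}$, $$B_k^-=\max\Big\{\rho+\sum_{j\in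 S_k^-}x_j^{k+1},\ \sum_{j\in S_k^-}\hat x_j\Big\},\qquad B_k^+=\min\Big\{\sum_{j\in S_k^+}x_j^{k+1},\ \sum_{j\in S_k^+}\hat x_j\Big\}.$$ Then: 1. $I_A^b(x^{k+1})\le I_A^b(x^k)$ for all $k$. 2. $\{x^k\}$ has a convergent subsequence (for which no use of condition 3 is needed), and the limit $\hat x$ is a fixed point of the EM operator, i.e. $P(\hat x)=\hat x$. 3. $I(\hat x,x^{k+1})\le I(\hat x,x^k)$ for all $k$, and $x^k\to\hat x$ as $k\to\infty$. 4. $\hat x$ is a minimizer of $I_A^b$ over $\mathbb{R}_+^N=\{x\in\mathbb{R}^N: x\ge 0\}$. Furthermore, for each $k$, the inequality in conclusion 1, respectively in conclusion 3, holds with equality if and only if $x^k$ is a fixed point of the EM operator and $\beta_k v^k=0$.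
   Context: For nonnegative vectors $x,y$ of the same length, the Kullback–Leibler (K-L) distance is $I(x,y)=\sum_j x_j\ln\frac{x_j}{y_j}-\sum_j(x_j-y_j)$, with the usual conventions $0\ln\frac{0}{y}=0$ for $y\ge 0$ and $x\ln\frac{x}{0}=+\infty$ for $x>0$. For $x\in\mathbb{R}^N_+=\{x\in\mathbb{R}^N:x\ge0\}$, with $d_i(x)=\sum_{j=1}^N a_{ij}x_j$, $$I_A^b(x)=I(b,Ax)=\sum_{i=1}^M b_i\ln\frac{b_i}{d_i(x)}-\sum_{i=1}^M\big(b_i-d_i(x)\big).$$ The EM operator $P=(P_1,\dots,P_N)^t$ is $P_j(x)=x_j f_j(x)$ with $f_j(x)=\frac{1}{H_j}\sum_{i=1}^M\frac{a_{ij}b_i}{d_i(x)}$ and $H_j=\sum_{i=1}^M a_{ij}$; here $H_j=1$ for all $j$. The perturbed EM iteration is thus $x^{k+1}=P(x^k+\beta_kv^k)$. A fixed point of $P$ is an $x\in\mathbb{R}^N_+$ with $P(x)=x$ (in particular $P$ is defined at $x$, i.e. $d_i(x)>0$ for all $i$). It is understood that the iteration is well defined, i.e. every row of $A$ is nonzero, so that $d_i(y)>0$ for all $i$ whenever $y>0$ componentwise. If $S_k^-$ (resp. $S_k^+$) is empty, the term in condition 3 containing the maximum over $S_k^-$ (resp. the minimum over $S_k^+$) is taken to be $0$. *)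

theory Defs
  imports "HOL-Analysis.Analysis"
begin

definition nonneg_orthant :: "(real ^ 'a) set"
  where "nonneg_orthant = {x. \<forall>j. 0 \<le> x $ j}"

text \<open>
  The Kullback--Leibler distance takes the value \<open>\<infinity>\<close>, hence the type \<open>ereal\<close>.
  It is meant for nonnegative vectors only; values at other arguments carry no meaning.
\<close>

definition kl_log_term :: "real \<Rightarrow> real \<Rightarrow> ereal"
  where "kl_log_term x y =
    (if x = 0 then 0 else if y = 0 then \<infinity> else ereal (x * ln (x / y)))"

definition kl_dist :: "real ^ 'a \<Rightarrow> real ^ 'a \<Rightarrow> ereal"
  where "kl_dist x y =
    (\<Sum>j\<in>UNIV. kl_log_term (x $ j) (y $ j)) - ereal (\<Sum>j\<in>UNIV. x $ j - y $ j)"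

definition kl_data :: "real ^ 'n ^ 'm \<Rightarrow> real ^ 'm \<Rightarrow> real ^ 'n \<Rightarrow> ereal"
  where "kl_data A b x = kl_dist b (A *v x)"

text \<open>
  \<open>(A *v x) $ i\<close> is the quantity usually written \<open>d\<^sub>i(x)\<close>, and the column sum in
  \<open>em_factor\<close> is \<open>H\<^sub>j\<close>.
\<close>

definition em_factor :: "real ^ 'n ^ 'm \<Rightarrow> real ^ 'm \<Rightarrow> real ^ 'n \<Rightarrow> 'n \<Rightarrow> real"
  where "em_factor A b x j =
    1 / (\<Sum>i\<in>UNIV. A $ i $ j) * (\<Sum>i\<in>UNIV. A $ i $ j * b $ i / (A *v x) $ i)"

lemma em_factor_normalized:
  assumes "(\<Sum>i\<in>UNIV. A $ i $ j) = 1"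
  shows "em_factor A b x j = (\<Sum>i\<in>UNIV. A $ i $ j * b $ i / (A *v x) $ i)"
  using assms by (simp add: em_factor_def)

definition em_op :: "real ^ 'n ^ 'm \<Rightarrow> real ^ 'm \<Rightarrow> real ^ 'n \<Rightarrow> real ^ 'n"
  where "em_op A b x = (\<chi> j. x $ j * em_factor A b x j)"

text \<open>
  Division is total in HOL, so the requirement that the operator be defined at a fixed
  point has to be stated explicitly.
\<close>

definition em_fixpoint :: "real ^ 'n ^ 'm \<Rightarrow> real ^ 'm \<Rightarrow> real ^ 'n \<Rightarrow> bool"
  where "em_fixpoint A b x \<longleftrightarrow>
    x \<in> nonneg_orthant \<and> (\<forall>i. 0 < (A *v x) $ i) \<and> em_op A b x = x"

definition neg_idx :: "real ^ 'n \<Rightarrow> 'n set"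
  where "neg_idx v = {j. v $ j < 0}"

definition pos_idx :: "real ^ 'n \<Rightarrow> 'n set"
  where "pos_idx v = {j. 0 < v $ j}"

text \<open>
  An extremum over an empty index set is set to \<open>0\<close>; it only occurs as a factor of a
  term that is then understood to be \<open>0\<close>.
\<close>

definition max_neg_ratio :: "real ^ 'n \<Rightarrow> real ^ 'n \<Rightarrow> real"
  where "max_neg_ratio v y =
    (if neg_idx v = {} then 0 else Max ((\<lambda>j. - (v $ j / y $ j)) ` neg_idx v))"

definition min_pos_ratio :: "real ^ 'n \<Rightarrow> real ^ 'n \<Rightarrow> real"
  where "min_pos_ratio v y =
    (if pos_idx v = {} then 0 else Min ((\<lambda>j. v $ j / y $ j) ` pos_idx v))"

definition B_minus :: "real \<Rightarrow> real ^ 'n \<Rightarrow> real ^ 'n \<Rightarrow> real ^ 'n \<Rightarrow> real"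
  where "B_minus \<rho> v x z =
    max (\<rho> + (\<Sum>j\<in>neg_idx v. x $ j)) (\<Sum>j\<in>neg_idx v. z $ j)"

definition B_plus :: "real ^ 'n \<Rightarrow> real ^ 'n \<Rightarrow> real ^ 'n \<Rightarrow> real"
  where "B_plus v x z = min (\<Sum>j\<in>pos_idx v. x $ j) (\<Sum>j\<in>pos_idx v. z $ j)"

end

(*
  Convexity bounds I(y) - I(x^k) by the left side of the decreasing condition, with the slack
  rho beta_k max(-v_j / y_j), so the loss I = I_A^b descends by more than this slack. Jensen's
  inequality gives I(y) - I(P(y)) >= I(P(y), y), and since the loss converges, every limit point is
  a fixed point. A second use of Jensen's inequality, with the weights a_ij b_i / d_i(xhat), shows
  that I(xhat, x^k) decreases, which turns subsequential into full convergence. For optimality one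
  needs f_j(xhat) <= 1: otherwise x^k_j would eventually increase, because the slack tends to 0 and
  so bounds the relative decrease caused by the perturbation.
*)
theory Submission
  imports Defs
begin

section \<open>Jensen's inequality for the logarithm and the Kullback-Leibler distance on real
  values\<close>

lemma ln_sum_ge:
  fixes w t :: "'a::finite \<Rightarrow> real"
  assumes "\<And>i. 0 \<le> w i" "sum w UNIV = 1" "\<And>i. 0 < t i"
  shows "(\<Sum>i\<in>UNIV. w i * ln (t i)) \<le> ln (\<Sum>i\<in>UNIV. w i * t i)"
  using concave_on_sum[OF finite UNIV_not_empty ln_concave, of w t] assms by simp

text \<open>Apply \<open>ln q \<le> q - 1\<close> to \<open>q = sqrt s / sqrt t\<close> and multiply
  by \<open>2 * t\<close>. The quadratic bound gives nonnegativity, identifies the equality case,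
  and later turns convergence in K-L distance into convergence of components.\<close>

lemma kl_term_ge:
  fixes s t :: real
  assumes "0 \<le> t" "0 < s"
  shows "(sqrt t - sqrt s)\<^sup>2 \<le> t * ln (t / s) - t + s"
proof (cases "t = 0")
  case False
  then have t: "0 < t" using assms by simp
  define q where "q = sqrt s / sqrt t"
  have "ln (t / s) = - 2 * ln q"
    unfolding q_def using t assms by (simp add: ln_div ln_sqrt)
  moreover have "ln q \<le> q - 1"
    unfolding q_def using t assms by (intro ln_le_minus_one) simp
  ultimately have "2 * (1 - q) \<le> ln (t / s)" by simp
  from mult_left_mono[OF this assms(1)]
  have "2 * t - 2 * (t * q) \<le> t * ln (t / s)"
    by (simp only: algebra_simps)
  moreover have "t * q = t / sqrt t * sqrt s"
    by (simp add: q_def)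
  then have "t * q = sqrt t * sqrt s"
    by (simp only: real_div_sqrt[OF assms(1)])
  ultimately have "2 * t - 2 * (sqrt t * sqrt s) \<le> t * ln (t / s)"
    by (simp only:)
  then show ?thesis
    using assms by (simp add: power2_diff)
qed (use assms in simp)

text \<open>Real-valued form of \<open>kl_dist\<close> for positive \<open>w\<close>, grouped so
  that each summand is nonnegative when \<open>u\<close> is. A zero component of \<open>u\<close>
  contributes only \<open>w $ i\<close>, as the convention demands.\<close>

definition kl_loss :: "real ^ 'm \<Rightarrow> real ^ 'm \<Rightarrow> real"
  where "kl_loss u w = (\<Sum>i\<in>UNIV. u $ i * ln (u $ i / w $ i) - u $ i + w $ i)"

lemma kl_dist_eq_kl_loss:
  assumes "\<And>i. 0 < w $ i"
  shows "kl_dist u w = ereal (kl_loss u w)"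
proof -
  have "kl_log_term (u $ i) (w $ i) = ereal (u $ i * ln (u $ i / w $ i))" for i
    using assms[of i] by (simp add: kl_log_term_def)
  then show ?thesis
    by (simp add: kl_dist_def kl_loss_def sum.distrib sum_subtractf algebra_simps)
qed

lemma kl_loss_term_nonneg:
  fixes u w :: "real ^ 'm"
  assumes "0 \<le> u $ i" "0 < w $ i"
  shows "0 \<le> u $ i * ln (u $ i / w $ i) - u $ i + w $ i"
  using kl_term_ge[OF assms] zero_le_power2[of "sqrt (u $ i) - sqrt (w $ i)"] by linarith

lemma kl_loss_nonneg:
  assumes "\<And>i. 0 \<le> u $ i" "\<And>i. 0 < w $ i"
  shows "0 \<le> kl_loss u w"
  unfolding kl_loss_def by (intro sum_nonneg kl_loss_term_nonneg assms)

lemma kl_loss_ge_term: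
  assumes "\<And>i. 0 \<le> u $ i" "\<And>i. 0 < w $ i"
  shows "u $ i * ln (u $ i / w $ i) - u $ i + w $ i \<le> kl_loss u w"
  unfolding kl_loss_def
  by (rule member_le_sum) (auto intro: kl_loss_term_nonneg assms)

section \<open>Extremal ratios of a perturbation\<close>

text \<open>Indices with \<open>v $ j = 0\<close> drop out; on the other two index sets each ratio
  is replaced by its extremum. This brings a linear perturbation term into the shape of the
  decreasing condition.\<close>

lemma ratio_sum_le:
  fixes u v y :: "real ^ 'n"
  assumes "\<And>j. 0 \<le> u $ j"
  shows "- (\<Sum>j\<in>UNIV. v $ j / y $ j * u $ j)
    \<le> max_neg_ratio v y * (\<Sum>j\<in>neg_idx v. u $ j) - min_pos_ratio v y * (\<Sum>j\<in>pos_idx v. u $ j)"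
proof -
  let ?r = "\<lambda>j. v $ j / y $ j * u $ j"
  have "sum ?r UNIV = sum ?r (neg_idx v \<union> pos_idx v)"
    by (rule sum.mono_neutral_right) (auto simp: neg_idx_def pos_idx_def not_less intro: antisym)
  also have "\<dots> = sum ?r (neg_idx v) + sum ?r (pos_idx v)"
    by (rule sum.union_disjoint) (auto simp: neg_idx_def pos_idx_def)
  finally have split: "sum ?r UNIV = sum ?r (neg_idx v) + sum ?r (pos_idx v)" .
  have "- sum ?r (neg_idx v) \<le> max_neg_ratio v y * (\<Sum>j\<in>neg_idx v. u $ j)"
    unfolding sum_negf[symmetric] sum_distrib_left
  proof (rule sum_mono)
    fix j assume j: "j \<in> neg_idx v"
    then have "- (v $ j / y $ j) \<le> max_neg_ratio v y"
      by (auto simp: max_neg_ratio_def intro!: Max_ge)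
    from mult_right_mono[OF this assms[of j]]
    show "- ?r j \<le> max_neg_ratio v y * u $ j" by simp
  qed
  moreover have "min_pos_ratio v y * (\<Sum>j\<in>pos_idx v. u $ j) \<le> sum ?r (pos_idx v)"
    unfolding sum_distrib_left
  proof (rule sum_mono)
    fix j assume j: "j \<in> pos_idx v"
    then have "min_pos_ratio v y \<le> v $ j / y $ j"
      by (auto simp: min_pos_ratio_def intro!: Min_le)
    from mult_right_mono[OF this assms[of j]]
    show "min_pos_ratio v y * u $ j \<le> ?r j" .
  qed
  ultimately show ?thesis using split by linarith
qed

lemma max_neg_ratio_nonneg:
  assumes "\<And>j. 0 < y $ j"
  shows "0 \<le> max_neg_ratio v y"
proof (cases "neg_idx v = {}")
  case False
  then obtain j where j: "j \<in> neg_idx v" by blast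
  then have "0 \<le> - (v $ j / y $ j)"
    using assms[of j] by (simp add: neg_idx_def divide_le_0_iff)
  also have "\<dots> \<le> max_neg_ratio v y"
    using j by (auto simp: max_neg_ratio_def intro!: Max_ge)
  finally show ?thesis .
qed (simp add: max_neg_ratio_def)

lemma min_pos_ratio_nonneg:
  assumes "\<And>j. 0 < y $ j"
  shows "0 \<le> min_pos_ratio v y"
  using assms by (auto simp: min_pos_ratio_def pos_idx_def less_imp_le)

lemma max_neg_ratio_ge:
  assumes "\<And>j. 0 < y $ j"
  shows "- (v $ j / y $ j) \<le> max_neg_ratio v y"
proof (cases "j \<in> neg_idx v")
  case True
  then show ?thesis by (auto simp: max_neg_ratio_def intro!: Max_ge)
next
  case False
  then have "- (v $ j / y $ j) \<le> 0"
    using assms[of j] by (simp add: neg_idx_def)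
  then show ?thesis using max_neg_ratio_nonneg[OF assms, of v] by linarith
qed

section \<open>The EM operator and its loss\<close>

locale em_problem =
  fixes A :: "real ^ 'n ^ 'm" and b :: "real ^ 'm"
  assumes A_nonneg: "\<And>i j. 0 \<le> A $ i $ j"
    and A_col_sum: "\<And>j. (\<Sum>i\<in>UNIV. A $ i $ j) = 1"
    and A_row_nonzero: "\<And>i. \<exists>j. A $ i $ j \<noteq> 0"
    and b_pos: "\<And>i. 0 < b $ i"
begin

abbreviation d :: "real ^ 'n \<Rightarrow> 'm \<Rightarrow> real"
  where "d u i \<equiv> (A *v u) $ i"

abbreviation f :: "real ^ 'n \<Rightarrow> 'n \<Rightarrow> real"
  where "f u j \<equiv> em_factor A b u j"

abbreviation J :: "real ^ 'n \<Rightarrow> real"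
  where "J u \<equiv> kl_loss b (A *v u)"

lemma d_eq: "d u i = (\<Sum>j\<in>UNIV. A $ i $ j * u $ j)"
  by (simp add: matrix_vector_mult_def)

lemma f_eq: "f u j = (\<Sum>i\<in>UNIV. A $ i $ j * b $ i / d u i)"
  by (rule em_factor_normalized[OF A_col_sum])

lemma d_nonneg: "(\<And>j. 0 \<le> u $ j) \<Longrightarrow> 0 \<le> d u i"
  by (simp add: d_eq sum_nonneg A_nonneg)

lemma d_pos:
  assumes "\<And>j. 0 < u $ j"
  shows "0 < d u i"
proof -
  obtain j where "0 < A $ i $ j"
    using A_row_nonzero[of i] A_nonneg[of i] by (metis less_le)
  then show ?thesis
    unfolding d_eq using assms
    by (intro sum_pos2[of _ j]) (auto simp: A_nonneg less_imp_le)
qed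

lemma f_pos:
  assumes "\<And>i. 0 < d u i"
  shows "0 < f u j"
proof -
  obtain i where "0 < A $ i $ j"
    using A_col_sum[of j] A_nonneg[of _ j]
    by (metis (no_types, lifting) less_le sum.neutral zero_neq_one)
  then show ?thesis
    unfolding f_eq using assms b_pos
    by (intro sum_pos2[of _ i]) (auto simp: A_nonneg less_imp_le)
qed

text \<open>A positive summand of \<open>d p i\<close> stays positive after multiplication by the
  factor \<open>f p j\<close>. This covers points with zero components, such as limits of
  iterates.\<close>

lemma d_em_op_pos:
  assumes nn: "\<And>j. 0 \<le> p $ j" and p: "\<And>i. 0 < d p i"
  shows "0 < d (em_op A b p) i"
proof -
  obtain j where "0 < A $ i $ j * p $ j"
    using p[of i] A_nonneg[of i] nn unfolding d_eq
    by (metis (no_types, lifting) less_irrefl less_le mult_nonneg_nonneg sum.neutral)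
  then show ?thesis
    unfolding d_eq[of "em_op A b p"]
    by (intro sum_pos2[of _ j])
      (auto simp: em_op_def A_nonneg nn p f_pos less_imp_le mult.assoc[symmetric])
qed

lemma sum_d: "(\<Sum>i\<in>UNIV. d u i) = (\<Sum>j\<in>UNIV. u $ j)"
proof -
  have "(\<Sum>i\<in>UNIV. d u i) = (\<Sum>j\<in>UNIV. \<Sum>i\<in>UNIV. A $ i $ j * u $ j)"
    unfolding d_eq by (rule sum.swap)
  then show ?thesis by (simp add: sum_distrib_right[symmetric] A_col_sum)
qed

text \<open>\<open>f p\<close> is the transpose of \<open>A\<close> applied to the vector of the
  \<open>b $ i / d p i\<close>, so this is the duality between \<open>A\<close> and its
  transpose.\<close>

lemma sum_f_mult: "(\<Sum>j\<in>UNIV. f p j * u $ j) = (\<Sum>i\<in>UNIV. b $ i / d p i * d u i)"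
proof -
  have "(\<Sum>j\<in>UNIV. f p j * u $ j) = (\<Sum>i\<in>UNIV. \<Sum>j\<in>UNIV. A $ i $ j * b $ i / d p i * u $ j)"
    unfolding f_eq sum_distrib_right by (rule sum.swap)
  also have "\<dots> = (\<Sum>i\<in>UNIV. b $ i / d p i * d u i)"
    unfolding d_eq[of u] sum_distrib_left
    by (intro sum.cong refl) (simp add: mult_ac)
  finally show ?thesis .
qed

lemma sum_em_op:
  assumes "\<And>i. 0 < d p i"
  shows "(\<Sum>j\<in>UNIV. em_op A b p $ j) = (\<Sum>i\<in>UNIV. b $ i)"
proof -
  have "(\<Sum>j\<in>UNIV. em_op A b p $ j) = (\<Sum>j\<in>UNIV. f p j * p $ j)"
    by (simp add: em_op_def mult.commute)
  also have "\<dots> = (\<Sum>i\<in>UNIV. b $ i)"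
    unfolding sum_f_mult using assms by (intro sum.cong refl) (simp add: less_imp_neq[symmetric])
  finally show ?thesis .
qed

lemma kl_data_eq:
  assumes "\<And>i. 0 < d u i"
  shows "kl_data A b u = ereal (J u)"
  unfolding kl_data_def by (rule kl_dist_eq_kl_loss[OF assms])

lemma kl_data_top:
  assumes "d u i = 0"
  shows "kl_data A b u = \<infinity>"
proof -
  have "kl_log_term (b $ i) (d u i) = \<infinity>"
    using assms b_pos[of i] by (simp add: kl_log_term_def)
  then have "(\<Sum>i\<in>UNIV. kl_log_term (b $ i) (d u i)) = \<infinity>"
    by (subst sum_Pinfty) auto
  then show ?thesis by (simp add: kl_data_def kl_dist_def)
qed

text \<open>Convexity of \<open>J\<close>: since the columns sum to 1, \<open>1 - f p j\<close> is
  the partial derivative at \<open>p\<close>. Row by row the claim is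
  \<open>ln t \<le> t - 1\<close> at \<open>t = d q i / d p i\<close>.\<close>

lemma J_gradient_ineq:
  assumes p: "\<And>i. 0 < d p i" and q: "\<And>i. 0 < d q i"
  shows "J p + (\<Sum>j\<in>UNIV. (1 - f p j) * (q $ j - p $ j)) \<le> J q"
proof -
  have "(\<Sum>j\<in>UNIV. (1 - f p j) * (q $ j - p $ j))
      = (\<Sum>j\<in>UNIV. (q - p) $ j) - (\<Sum>j\<in>UNIV. f p j * (q - p) $ j)"
    by (simp add: left_diff_distrib sum_subtractf)
  also have "\<dots> = (\<Sum>i\<in>UNIV. d (q - p) i - b $ i / d p i * d (q - p) i)"
    unfolding sum_f_mult sum_d[symmetric] by (simp add: sum_subtractf)
  finally have "J p + (\<Sum>j\<in>UNIV. (1 - f p j) * (q $ j - p $ j))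
      = (\<Sum>i\<in>UNIV. (b $ i * ln (b $ i / d p i) - b $ i + d p i)
          + (d (q - p) i - b $ i / d p i * d (q - p) i))"
    by (simp add: kl_loss_def sum.distrib)
  also have "\<dots> \<le> J q"
    unfolding kl_loss_def
  proof (rule sum_mono)
    fix i
    have "ln (d q i / d p i) \<le> d q i / d p i - 1"
      using p q by (intro ln_le_minus_one) simp
    then have "b $ i * ln (d q i / d p i) \<le> b $ i * (d q i / d p i - 1)"
      using b_pos[of i] by simp
    moreover have "b $ i / d p i * d (q - p) i = b $ i * (d q i / d p i - 1)"
      using p[of i] by (simp add: matrix_vector_mult_diff_distrib field_simps)
    ultimately show "(b $ i * ln (b $ i / d p i) - b $ i + d p i)
        + (d (q - p) i - b $ i / d p i * d (q - p) i) \<le> b $ i * ln (b $ i / d q i) - b $ i + d q i"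
      using p[of i] q[of i] b_pos[of i]
      by (simp add: matrix_vector_mult_diff_distrib ln_div algebra_simps)
  qed
  finally show ?thesis .
qed

text \<open>
  Jensen's inequality for the weights \<open>a\<^sub>i\<^sub>j p\<^sub>j / d\<^sub>i(p)\<close>, with \<open>d\<^sub>i(P(p)) / d\<^sub>i(p)\<close> as the mean
  of the \<open>f\<^sub>j(p)\<close>.
\<close>

lemma J_em_op_descent:
  assumes nn: "\<And>j. 0 \<le> p $ j" and p: "\<And>i. 0 < d p i"
  shows "(\<Sum>j\<in>UNIV. p $ j * (f p j * ln (f p j) - f p j + 1)) \<le> J p - J (em_op A b p)"
proof -
  let ?z = "em_op A b p"
  have jensen: "(\<Sum>j\<in>UNIV. A $ i $ j * p $ j / d p i * ln (f p j)) \<le> ln (d ?z i / d p i)" for i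
  proof -
    have "(\<Sum>j\<in>UNIV. A $ i $ j * p $ j / d p i * f p j) = d ?z i / d p i"
      unfolding d_eq[of ?z] by (simp add: em_op_def sum_divide_distrib mult_ac)
    moreover have "(\<Sum>j\<in>UNIV. A $ i $ j * p $ j / d p i) = 1"
      using p[of i] by (simp add: sum_divide_distrib[symmetric] d_eq[symmetric])
    ultimately show ?thesis
      using ln_sum_ge[of "\<lambda>j. A $ i $ j * p $ j / d p i" "f p"] f_pos[of p] p A_nonneg nn
      by (simp add: less_imp_le)
  qed
  have z: "0 < d ?z i" for i
    by (rule d_em_op_pos[OF nn p])
  have "(\<Sum>j\<in>UNIV. p $ j * f p j * ln (f p j))
      = (\<Sum>j\<in>UNIV. f p j * (\<chi> j. p $ j * ln (f p j)) $ j)"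
    by (simp add: mult_ac)
  \<comment> \<open>Duality for the vector of the \<open>p $ j * ln (f p j)\<close> produces exactly
    the Jensen means, weighted by \<open>b $ i\<close>.\<close>
  also have "\<dots> = (\<Sum>i\<in>UNIV. b $ i * (\<Sum>j\<in>UNIV. A $ i $ j * p $ j / d p i * ln (f p j)))"
    unfolding sum_f_mult d_eq[of "\<chi> j. _ j"] sum_distrib_left
    by (intro sum.cong refl) (simp add: mult_ac)
  also have "\<dots> \<le> (\<Sum>i\<in>UNIV. b $ i * ln (d ?z i / d p i))"
    by (intro sum_mono mult_left_mono jensen less_imp_le b_pos)
  also have "\<dots> = (\<Sum>i\<in>UNIV. b $ i * ln (b $ i / d p i) - b $ i * ln (b $ i / d ?z i))"
  proof (intro sum.cong refl)
    fix i
    show "b $ i * ln (d ?z i / d p i) = b $ i * ln (b $ i / d p i) - b $ i * ln (b $ i / d ?z i)"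
      using p[of i] z[of i] b_pos[of i] by (simp add: ln_div algebra_simps)
  qed
  also have "\<dots> = J p - J ?z - (\<Sum>i\<in>UNIV. d p i) + (\<Sum>i\<in>UNIV. d ?z i)"
    by (simp add: kl_loss_def sum.distrib sum_subtractf)
  also have "\<dots> = J p - J ?z - (\<Sum>j\<in>UNIV. p $ j - p $ j * f p j)"
    unfolding sum_d by (simp add: em_op_def sum_subtractf)
  finally show ?thesis
    by (simp add: algebra_simps sum.distrib sum_subtractf)
qed

text \<open>The lower bound on the descent is a sum of nonnegative terms, so all of them vanish.
  Each dominates \<open>p $ j * (sqrt (f p j) - 1)\<^sup>2\<close>, which leaves
  \<open>p $ j = 0\<close> or \<open>f p j = 1\<close>.\<close>

lemma em_op_fixed_of_no_descent:
  assumes nn: "\<And>j. 0 \<le> p $ j" and p: "\<And>i. 0 < d p i" and le: "J p \<le> J (em_op A b p)"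
  shows "em_op A b p = p"
proof -
  let ?h = "\<lambda>j. p $ j * (f p j * ln (f p j) - f p j + 1)"
  have h: "p $ j * (sqrt (f p j) - 1)\<^sup>2 \<le> ?h j" for j
    using kl_term_ge[of "f p j" 1] f_pos[OF p, of j] nn[of j] by (simp add: mult_left_mono)
  have h0: "0 \<le> ?h j" for j
    by (rule order_trans[OF _ h]) (simp add: nn)
  have "sum ?h UNIV \<le> 0"
    using J_em_op_descent[OF nn p] le by linarith
  then have "sum ?h UNIV = 0"
    by (rule antisym) (intro sum_nonneg h0)
  then have "?h j = 0" for j
    using sum_nonneg_eq_0_iff[of UNIV ?h] h0 by auto
  then have "p $ j * (sqrt (f p j) - 1)\<^sup>2 = 0" for j
    using h[of j] nn[of j] by (metis antisym mult_nonneg_nonneg zero_le_power2)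
  then have "p $ j = 0 \<or> f p j = 1" for j
    by (auto simp: algebra_simps)
  then show ?thesis
    by (metis (mono_tags, lifting) em_op_def mult.right_neutral mult_zero_left vec_eq_iff vec_lambda_beta)
qed

text \<open>
  At a fixed point \<open>f\<^sub>j(p) = 1\<close> wherever \<open>p\<^sub>j > 0\<close>, so the numbers \<open>a\<^sub>i\<^sub>j b\<^sub>i / d\<^sub>i(p)\<close> are weights
  over \<open>i\<close>, and \<open>f\<^sub>j(q)\<close> is the mean of the \<open>d\<^sub>i(p) / d\<^sub>i(q)\<close>.
\<close>

lemma fixpoint_sum_ln_f_ge:
  assumes fp: "em_fixpoint A b p" and q: "\<And>i. 0 < d q i"
  shows "J q - J p - (\<Sum>j\<in>UNIV. q $ j) + (\<Sum>j\<in>UNIV. p $ j) \<le> (\<Sum>j\<in>UNIV. p $ j * ln (f q j))"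
proof -
  have p: "\<And>i. 0 < d p i" and nn: "\<And>j. 0 \<le> p $ j" and eq: "\<And>j. p $ j * f p j = p $ j"
    using fp by (auto simp: em_fixpoint_def nonneg_orthant_def em_op_def vec_eq_iff)
  let ?w = "\<lambda>j i. A $ i $ j * b $ i / d p i"
  have jensen: "p $ j * (\<Sum>i\<in>UNIV. ?w j i * ln (d p i / d q i)) \<le> p $ j * ln (f q j)" for j
  proof (cases "p $ j = 0")
    case False
    then have "sum (?w j) UNIV = 1" using eq[of j] by (simp add: f_eq)
    moreover have "(\<Sum>i\<in>UNIV. ?w j i * (d p i / d q i)) = f q j"
      unfolding f_eq using p by (intro sum.cong refl) (simp add: less_imp_neq[symmetric])
    ultimately have "(\<Sum>i\<in>UNIV. ?w j i * ln (d p i / d q i)) \<le> ln (f q j)"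
      using ln_sum_ge[of "?w j" "\<lambda>i. d p i / d q i"] p q A_nonneg b_pos
      by (simp add: less_imp_le)
    then show ?thesis by (rule mult_left_mono[OF _ nn])
  qed simp
  have "J q - J p - (\<Sum>j\<in>UNIV. q $ j) + (\<Sum>j\<in>UNIV. p $ j)
      = (\<Sum>i\<in>UNIV. b $ i * ln (b $ i / d q i) - b $ i * ln (b $ i / d p i))"
    unfolding sum_d[symmetric] by (simp add: kl_loss_def sum.distrib sum_subtractf)
  also have "\<dots> = (\<Sum>i\<in>UNIV. b $ i * ln (d p i / d q i))"
  proof (intro sum.cong refl)
    fix i
    show "b $ i * ln (b $ i / d q i) - b $ i * ln (b $ i / d p i) = b $ i * ln (d p i / d q i)"
      using p[of i] q[of i] b_pos[of i] by (simp add: ln_div algebra_simps)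
  qed
  \<comment> \<open>Expanding \<open>d p i\<close> over \<open>j\<close> splits \<open>b $ i\<close>
    into the parts \<open>p $ j * ?w j i\<close>.\<close>
  also have "\<dots> = (\<Sum>i\<in>UNIV. \<Sum>j\<in>UNIV. p $ j * (?w j i * ln (d p i / d q i)))"
  proof (intro sum.cong refl)
    fix i
    have "(\<Sum>j\<in>UNIV. p $ j * (?w j i * ln (d p i / d q i)))
        = d p i * (b $ i / d p i * ln (d p i / d q i))"
      unfolding d_eq[of p] sum_distrib_right by (intro sum.cong refl) (simp add: mult_ac)
    then show "b $ i * ln (d p i / d q i) = (\<Sum>j\<in>UNIV. p $ j * (?w j i * ln (d p i / d q i)))"
      using p[of i] by simp
  qed
  also have "\<dots> = (\<Sum>j\<in>UNIV. p $ j * (\<Sum>i\<in>UNIV. ?w j i * ln (d p i / d q i)))"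
    unfolding sum_distrib_left by (rule sum.swap)
  also have "\<dots> \<le> (\<Sum>j\<in>UNIV. p $ j * ln (f q j))"
    by (intro sum_mono jensen)
  finally show ?thesis .
qed

text \<open>These are the Karush-Kuhn-Tucker conditions: the gradient \<open>1 - f p j\<close> is
  nonnegative and, by the fixed point equation, complementary to \<open>p $ j\<close>. Convexity
  makes them sufficient; points \<open>z\<close> with some \<open>d z i = 0\<close> have infinite
  loss.\<close>

lemma fixpoint_minimizer:
  assumes fp: "em_fixpoint A b p" and le1: "\<And>j. f p j \<le> 1" and z: "z \<in> nonneg_orthant"
  shows "kl_data A b p \<le> kl_data A b z"
proof (cases "\<exists>i. d z i = 0")
  case False
  have zn: "\<And>j. 0 \<le> z $ j" using z by (simp add: nonneg_orthant_def)
  have dz: "\<And>i. 0 < d z i" using False d_nonneg[OF zn] by (metis less_le)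
  have p: "\<And>i. 0 < d p i" and eq: "\<And>j. p $ j * f p j = p $ j"
    using fp by (auto simp: em_fixpoint_def em_op_def vec_eq_iff)
  have "(1 - f p j) * (z $ j - p $ j) = (1 - f p j) * z $ j" for j
    using eq[of j] by (simp add: algebra_simps)
  moreover have "0 \<le> (1 - f p j) * z $ j" for j
    using le1[of j] zn[of j] by simp
  ultimately have "0 \<le> (\<Sum>j\<in>UNIV. (1 - f p j) * (z $ j - p $ j))"
    by (metis (no_types, lifting) sum_nonneg)
  then show ?thesis
    using J_gradient_ineq[OF p dz] by (simp add: kl_data_eq p dz)
qed (auto simp: kl_data_top)

section \<open>Continuity where all \<open>d p i\<close> are positive\<close>

lemma tendsto_d: "(s \<longlongrightarrow> p) F \<Longrightarrow> ((\<lambda>n. d (s n) i) \<longlongrightarrow> d p i) F"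
  unfolding d_eq by (intro tendsto_intros)

lemma tendsto_f:
  assumes "(s \<longlongrightarrow> p) F" "\<And>i. 0 < d p i"
  shows "((\<lambda>n. f (s n) j) \<longlongrightarrow> f p j) F"
  unfolding f_eq using assms
  by (intro tendsto_intros tendsto_d) (auto simp: less_imp_neq[symmetric])

lemma tendsto_J:
  assumes "(s \<longlongrightarrow> p) F" "\<And>i. 0 < d p i"
  shows "((\<lambda>n. J (s n)) \<longlongrightarrow> J p) F"
proof -
  have "b $ i / d p i \<noteq> 0" "d p i \<noteq> 0" for i
    using assms(2)[of i] b_pos[of i] by auto
  then show ?thesis
    unfolding kl_loss_def using assms(1) by (intro tendsto_intros tendsto_d)
qed

lemma tendsto_em_op:
  assumes "(s \<longlongrightarrow> p) F" "\<And>i. 0 < d p i"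
  shows "((\<lambda>n. em_op A b (s n)) \<longlongrightarrow> em_op A b p) F"
  unfolding em_op_def by (intro tendsto_intros tendsto_f assms)

text \<open>A bound on the loss keeps \<open>d\<^sub>i\<close> away from \<open>0\<close>, so limits stay inside its finite domain.\<close>

lemma d_ge_of_J_le:
  assumes u: "\<And>i. 0 < d u i" and le: "J u \<le> c"
  shows "b $ i * exp (- ((c + b $ i) / b $ i)) \<le> d u i"
proof -
  \<comment> \<open>One summand is at most the whole loss; its positive part \<open>d u i\<close> is
    discarded.\<close>
  have "b $ i * ln (b $ i / d u i) \<le> c + b $ i"
    using kl_loss_ge_term[of b "A *v u" i] u b_pos le by (smt (verit))
  then have "ln (b $ i / d u i) \<le> (c + b $ i) / b $ i"
    using b_pos[of i] by (simp add: field_simps)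
  then have "- ((c + b $ i) / b $ i) \<le> ln (d u i / b $ i)"
    using u[of i] b_pos[of i] by (simp add: ln_div)
  then have "exp (- ((c + b $ i) / b $ i)) \<le> d u i / b $ i"
    using u[of i] b_pos[of i] by (metis divide_pos_pos exp_le_cancel_iff exp_ln)
  then show ?thesis
    using b_pos[of i] by (simp add: field_simps)
qed

end

section \<open>The perturbed iteration: positivity and boundedness\<close>

locale perturbed_em = em_problem A b
  for A :: "real ^ 'n ^ 'm" and b :: "real ^ 'm" +
  fixes x y v :: "nat \<Rightarrow> real ^ 'n" and \<beta> :: "nat \<Rightarrow> real"
  assumes x0_pos: "\<And>j. 0 < x 0 $ j"
    and \<beta>_pos: "\<And>k. 0 < \<beta> k"
    and v_bounded: "bounded (range v)"
    and y_def: "\<And>k. y k = x k + \<beta> k *\<^sub>R v k"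
    and iteration: "\<And>k. x (Suc k) = em_op A b (y k)"
    and y_pos: "\<And>k j. 0 < y k $ j"
    and vanishing: "\<beta> \<longlonglongrightarrow> 0"
begin

lemma x_Suc: "x (Suc k) $ j = y k $ j * f (y k) j"
  by (simp add: iteration em_op_def)

lemma x_pos: "0 < x k $ j"
  by (cases k) (simp_all add: x0_pos x_Suc y_pos f_pos d_pos)

lemma d_x_pos: "0 < d (x k) i" and d_y_pos: "0 < d (y k) i"
  by (simp_all add: d_pos x_pos y_pos)

lemma y_nth: "y k $ j = x k $ j + \<beta> k * v k $ j"
  by (simp add: y_def)

lemma sum_x: "(\<Sum>j\<in>UNIV. x (Suc k) $ j) = (\<Sum>i\<in>UNIV. b $ i)"
  by (simp add: iteration sum_em_op d_y_pos)

text \<open>Every EM step yields total mass \<open>sum\<close> of the \<open>b $ i\<close>, which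
  bounds the norm of all iterates after \<open>x 0\<close>.\<close>

lemma x_bounded: "bounded (range x)"
proof -
  have "norm (x (Suc k)) \<le> (\<Sum>i\<in>UNIV. b $ i)" for k
    using norm_le_l1_cart[of "x (Suc k)"] x_pos[of "Suc k"] by (simp add: sum_x less_imp_le)
  then have "bounded (range (\<lambda>k. x (Suc k)))"
    by (auto intro: boundedI)
  moreover have "range x = insert (x 0) (range (\<lambda>k. x (Suc k)))"
    by (auto simp: image_iff) (metis not0_implies_Suc)
  ultimately show ?thesis by simp
qed

lemma convergent_subsequence: "\<exists>l r. strict_mono r \<and> (x \<circ> r) \<longlonglongrightarrow> l"
  using bounded_imp_convergent_subsequence[OF x_bounded] by blast

lemma y_minus_x_tendsto: "(\<lambda>k. y k - x k) \<longlonglongrightarrow> 0"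
proof -
  obtain B where "\<And>k. norm (v k) \<le> B"
    using v_bounded by (auto simp: bounded_iff)
  then have "(\<lambda>k. \<beta> k *\<^sub>R v k) \<longlonglongrightarrow> 0"
    by (intro lim_null_scaleR_bounded[OF vanishing, of _ B]) simp
  then show ?thesis by (simp add: y_def)
qed

end

section \<open>Descent of the loss under the decreasing condition\<close>

locale perturbed_em_decreasing = perturbed_em +
  fixes \<rho> :: real and xhat m
  assumes \<rho>_pos: "0 < \<rho>"
    and m_mono: "strict_mono m" and x_m_tendsto: "(x \<circ> m) \<longlonglongrightarrow> xhat"
    and decreasing: "\<And>k. \<beta> k * max_neg_ratio (v k) (y k) * B_minus \<rho> (v k) (x (Suc k)) xhat
        - \<beta> k * min_pos_ratio (v k) (y k) * B_plus (v k) (x (Suc k)) xhat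
        + \<beta> k * (\<Sum>j\<in>UNIV. v k $ j) < J (y k) - J (x (Suc k))"
begin

text \<open>Bounds the decrease caused by the perturbation relative to \<open>y k\<close>:
  \<open>x k $ j \<le> y k $ j * (1 + M k)\<close>.\<close>

abbreviation M :: "nat \<Rightarrow> real"
  where "M k \<equiv> \<beta> k * max_neg_ratio (v k) (y k)"

lemma M_nonneg: "0 \<le> M k"
  by (simp add: \<beta>_pos less_imp_le max_neg_ratio_nonneg y_pos)

lemma xhat_nonneg: "0 \<le> xhat $ j"
proof (rule LIMSEQ_le_const)
  show "(\<lambda>k. x (m k) $ j) \<longlonglongrightarrow> xhat $ j"
    using tendsto_vec_nth[OF x_m_tendsto, of j] by (simp add: o_def)
qed (auto intro: less_imp_le x_pos)

text \<open>Common core of both monotonicity proofs: \<open>u = x (Suc k)\<close> with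
  \<open>t = \<rho>\<close> serves the loss, \<open>u = xhat\<close> with \<open>t = 0\<close> the
  K-L distance. The maximum in \<open>B_minus\<close> and the minimum in \<open>B_plus\<close> admit
  both choices.\<close>

lemma perturbation_bound:
  assumes u: "\<And>j. 0 \<le> u $ j"
    and neg: "t + (\<Sum>j\<in>neg_idx (v k). u $ j) \<le> B_minus \<rho> (v k) (x (Suc k)) xhat"
    and pos: "B_plus (v k) (x (Suc k)) xhat \<le> (\<Sum>j\<in>pos_idx (v k). u $ j)"
  shows "t * M k + \<beta> k * ((\<Sum>j\<in>UNIV. v k $ j) - (\<Sum>j\<in>UNIV. v k $ j / y k $ j * u $ j))
    < J (y k) - J (x (Suc k))"
proof -
  have "\<beta> k * - (\<Sum>j\<in>UNIV. v k $ j / y k $ j * u $ j)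
    \<le> \<beta> k * (max_neg_ratio (v k) (y k) * (\<Sum>j\<in>neg_idx (v k). u $ j)
          - min_pos_ratio (v k) (y k) * (\<Sum>j\<in>pos_idx (v k). u $ j))"
    by (intro mult_left_mono ratio_sum_le u less_imp_le \<beta>_pos)
  moreover have "M k * (t + (\<Sum>j\<in>neg_idx (v k). u $ j)) \<le> M k * B_minus \<rho> (v k) (x (Suc k)) xhat"
    by (intro mult_left_mono neg M_nonneg)
  moreover have "\<beta> k * min_pos_ratio (v k) (y k) * B_plus (v k) (x (Suc k)) xhat
      \<le> \<beta> k * min_pos_ratio (v k) (y k) * (\<Sum>j\<in>pos_idx (v k). u $ j)"
    using \<beta>_pos by (intro mult_left_mono pos) (simp add: less_imp_le min_pos_ratio_nonneg y_pos)
  ultimately show ?thesis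
    using decreasing[of k] by (simp add: algebra_simps)
qed

lemma J_descent: "\<rho> * M k < J (x k) - J (x (Suc k))"
proof -
  have "(\<Sum>j\<in>UNIV. (1 - f (y k) j) * (x k $ j - y k $ j))
      = (\<Sum>j\<in>UNIV. \<beta> k * (v k $ j / y k $ j * x (Suc k) $ j) - \<beta> k * v k $ j)"
  proof (intro sum.cong refl)
    fix j
    have "x k $ j - y k $ j = - (\<beta> k * v k $ j)" by (simp add: y_nth)
    \<comment> \<open>This turns the gradient term at \<open>y k\<close> into the ratio sum with
      \<open>u = x (Suc k)\<close>.\<close>
    moreover have "v k $ j / y k $ j * x (Suc k) $ j = f (y k) j * v k $ j"
      using y_pos[of k j] by (simp add: x_Suc)
    ultimately show "(1 - f (y k) j) * (x k $ j - y k $ j)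
        = \<beta> k * (v k $ j / y k $ j * x (Suc k) $ j) - \<beta> k * v k $ j"
      by (simp only:) (simp add: algebra_simps)
  qed
  also have "\<dots> = - (\<beta> k * ((\<Sum>j\<in>UNIV. v k $ j) - (\<Sum>j\<in>UNIV. v k $ j / y k $ j * x (Suc k) $ j)))"
    by (simp add: sum_subtractf sum_distrib_left right_diff_distrib)
  finally show ?thesis
    using J_gradient_ineq[OF d_y_pos d_x_pos, of k k] perturbation_bound[of "x (Suc k)" \<rho> k]
    by (simp add: less_imp_le x_pos B_minus_def B_plus_def)
qed

lemma J_less: "J (x (Suc k)) < J (x k)"
  using J_descent[of k] M_nonneg[of k] \<rho>_pos by (smt (verit) mult_nonneg_nonneg)

lemma J_decseq: "decseq (\<lambda>k. J (x k))"
  by (simp add: decseq_Suc_iff less_imp_le J_less)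

text \<open>Components of \<open>xhat\<close> may vanish, so positivity comes from a lower bound
  along the iterates that is uniform in \<open>k\<close>, given by the initial loss.\<close>

lemma d_xhat_pos: "0 < d xhat i"
proof -
  have "J (x k) \<le> J (x 0)" for k
    using decseqD[OF J_decseq, of 0 k] by simp
  then have "b $ i * exp (- ((J (x 0) + b $ i) / b $ i)) \<le> d (x (m k)) i" for k
    by (intro d_ge_of_J_le d_x_pos)
  moreover have "(\<lambda>k. d (x (m k)) i) \<longlonglongrightarrow> d xhat i"
    using tendsto_d[OF x_m_tendsto, of i] by (simp add: o_def)
  ultimately have "b $ i * exp (- ((J (x 0) + b $ i) / b $ i)) \<le> d xhat i"
    by (intro LIMSEQ_le_const) auto
  then show ?thesis
    using b_pos[of i] by (smt (verit) exp_gt_zero mult_pos_pos)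
qed

lemma J_tendsto: "(\<lambda>k. J (x k)) \<longlonglongrightarrow> J xhat"
proof -
  have "0 \<le> J (x k)" for k
    by (intro kl_loss_nonneg less_imp_le b_pos d_x_pos)
  then obtain L where L: "(\<lambda>k. J (x k)) \<longlonglongrightarrow> L"
    using decseq_convergent[OF J_decseq, of 0] by blast
  then have "(\<lambda>k. J (x (m k))) \<longlonglongrightarrow> L"
    using LIMSEQ_subseq_LIMSEQ[OF _ m_mono] by (force simp: o_def)
  moreover have "(\<lambda>k. J (x (m k))) \<longlonglongrightarrow> J xhat"
    using tendsto_J[OF x_m_tendsto d_xhat_pos] by (simp add: o_def)
  ultimately show ?thesis using L LIMSEQ_unique by blast
qed

lemma J_xhat_le: "J xhat \<le> J (x k)"
  by (rule decseq_ge[OF J_decseq J_tendsto])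

text \<open>\<open>\<rho> * M k\<close> lies below consecutive differences of the convergent
  loss.\<close>

lemma M_tendsto: "M \<longlonglongrightarrow> 0"
proof (rule tendsto_sandwich[OF _ _ tendsto_const])
  have "(\<lambda>k. (J (x k) - J (x (Suc k))) / \<rho>) \<longlonglongrightarrow> (J xhat - J xhat) / \<rho>"
    using \<rho>_pos by (intro tendsto_intros J_tendsto LIMSEQ_Suc[OF J_tendsto]) auto
  then show "(\<lambda>k. (J (x k) - J (x (Suc k))) / \<rho>) \<longlonglongrightarrow> 0" by simp
  show "\<forall>\<^sub>F k in sequentially. 0 \<le> M k" by (simp add: M_nonneg)
  show "\<forall>\<^sub>F k in sequentially. M k \<le> (J (x k) - J (x (Suc k))) / \<rho>"
    using J_descent \<rho>_pos by (auto simp: field_simps less_imp_le)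
qed

section \<open>The limit point is a fixed point\<close>

lemma y_m_tendsto: "(\<lambda>k. y (m k)) \<longlonglongrightarrow> xhat"
  using tendsto_add[OF LIMSEQ_subseq_LIMSEQ[OF y_minus_x_tendsto m_mono] x_m_tendsto]
  by (simp add: o_def)

lemma em_op_xhat: "em_op A b xhat = xhat"
proof (rule em_op_fixed_of_no_descent[OF xhat_nonneg d_xhat_pos])
  let ?z = "em_op A b xhat"
  have lim: "(\<lambda>k. x (Suc (m k))) \<longlonglongrightarrow> ?z"
    unfolding iteration by (rule tendsto_em_op[OF y_m_tendsto d_xhat_pos])
  have "0 < d ?z i" for i
    by (rule d_em_op_pos[OF xhat_nonneg d_xhat_pos])
  then have "(\<lambda>k. J (x (Suc (m k)))) \<longlonglongrightarrow> J ?z"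
    by (intro tendsto_J[OF lim])
  \<comment> \<open>The whole loss sequence converges, so shifting the subsequence by one step keeps
    the limit.\<close>
  moreover have "(\<lambda>k. J (x (Suc (m k)))) \<longlonglongrightarrow> J xhat"
    using LIMSEQ_subseq_LIMSEQ[OF LIMSEQ_Suc[OF J_tendsto] m_mono] by (simp add: o_def)
  ultimately show "J xhat \<le> J ?z" using LIMSEQ_unique by force
qed

lemma fixpoint_xhat: "em_fixpoint A b xhat"
  by (simp add: em_fixpoint_def nonneg_orthant_def xhat_nonneg d_xhat_pos em_op_xhat)

section \<open>Monotone K-L distance to the limit point and full convergence\<close>

lemma kl_loss_xhat_diff:
  "kl_loss xhat (x (Suc k)) - kl_loss xhat (x k)
    = (\<Sum>j\<in>UNIV. xhat $ j * ln (x k $ j / y k $ j)) - (\<Sum>j\<in>UNIV. xhat $ j * ln (f (y k) j))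
      + (\<Sum>j\<in>UNIV. xhat $ j) - (\<Sum>j\<in>UNIV. x k $ j)"
proof -
  have "xhat $ j * ln (xhat $ j / x (Suc k) $ j) - xhat $ j * ln (xhat $ j / x k $ j)
      = xhat $ j * ln (x k $ j / y k $ j) - xhat $ j * ln (f (y k) j)" for j
    using xhat_nonneg[of j] x_pos[of k j] y_pos[of k j] f_pos[OF d_y_pos, of k j]
    by (cases "xhat $ j = 0") (simp_all add: x_Suc ln_div ln_mult algebra_simps)
  then have "(\<Sum>j\<in>UNIV. xhat $ j * ln (xhat $ j / x (Suc k) $ j))
      - (\<Sum>j\<in>UNIV. xhat $ j * ln (xhat $ j / x k $ j))
      = (\<Sum>j\<in>UNIV. xhat $ j * ln (x k $ j / y k $ j)) - (\<Sum>j\<in>UNIV. xhat $ j * ln (f (y k) j))"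
    by (simp add: sum_subtractf[symmetric])
  \<comment> \<open>As a fixed point, \<open>xhat\<close> is itself an EM image and has the same
    total mass.\<close>
  moreover have "(\<Sum>j\<in>UNIV. x (Suc k) $ j) = (\<Sum>j\<in>UNIV. xhat $ j)"
    using sum_em_op[OF d_xhat_pos] by (simp add: em_op_xhat sum_x)
  ultimately show ?thesis
    by (simp add: kl_loss_def sum.distrib sum_subtractf)
qed

text \<open>Bound \<open>ln (x k $ j / y k $ j)\<close> linearly and the sum of the
  \<open>ln (f (y k) j)\<close> by Jensen. The perturbation bound for \<open>xhat\<close> then
  cancels \<open>J (y k)\<close> and leaves \<open>J xhat - J (x (Suc k))\<close>, which is at most
  0.\<close>

lemma kl_xhat_less: "kl_loss xhat (x (Suc k)) < kl_loss xhat (x k)"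
proof -
  have "xhat $ j * ln (x k $ j / y k $ j) \<le> - (\<beta> k * (v k $ j / y k $ j * xhat $ j))" for j
  proof -
    have "ln (x k $ j / y k $ j) \<le> x k $ j / y k $ j - 1"
      using x_pos y_pos by (intro ln_le_minus_one) simp
    also have "\<dots> = - (\<beta> k * (v k $ j / y k $ j))"
      using y_pos[of k j] by (simp add: field_simps y_nth)
    finally show ?thesis
      using mult_left_mono[OF _ xhat_nonneg[of j]] by (fastforce simp: mult_ac)
  qed
  then have "(\<Sum>j\<in>UNIV. xhat $ j * ln (x k $ j / y k $ j))
      \<le> - (\<beta> k * (\<Sum>j\<in>UNIV. v k $ j / y k $ j * xhat $ j))"
    unfolding sum_distrib_left sum_negf[symmetric] by (rule sum_mono)
  moreover have "(\<Sum>j\<in>UNIV. y k $ j) = (\<Sum>j\<in>UNIV. x k $ j) + \<beta> k * (\<Sum>j\<in>UNIV. v k $ j)"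
    by (simp add: y_nth sum.distrib sum_distrib_left)
  ultimately show ?thesis
    using kl_loss_xhat_diff[of k] fixpoint_sum_ln_f_ge[OF fixpoint_xhat d_y_pos, of k]
      perturbation_bound[of xhat 0 k] J_xhat_le[of "Suc k"]
    by (simp add: xhat_nonneg B_minus_def B_plus_def right_diff_distrib)
qed

lemma kl_xhat_tendsto: "(\<lambda>k. kl_loss xhat (x k)) \<longlonglongrightarrow> 0"
proof -
  let ?K = "\<lambda>k. kl_loss xhat (x k)"
  have dec: "decseq ?K" by (simp add: decseq_Suc_iff less_imp_le kl_xhat_less)
  have "0 \<le> ?K k" for k
    by (intro kl_loss_nonneg xhat_nonneg x_pos)
  then obtain L where L: "?K \<longlonglongrightarrow> L"
    using decseq_convergent[OF dec, of 0] by blast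
  then have "(\<lambda>k. ?K (m k)) \<longlonglongrightarrow> L"
    using LIMSEQ_subseq_LIMSEQ[OF _ m_mono] by (force simp: o_def)
  moreover have "(\<lambda>k. ?K (m k)) \<longlonglongrightarrow> kl_loss xhat xhat"
    unfolding kl_loss_def
  proof (rule tendsto_sum)
    fix j
    have lim: "(\<lambda>k. x (m k) $ j) \<longlonglongrightarrow> xhat $ j"
      using tendsto_vec_nth[OF x_m_tendsto, of j] by (simp add: o_def)
    show "(\<lambda>k. xhat $ j * ln (xhat $ j / x (m k) $ j) - xhat $ j + x (m k) $ j)
        \<longlonglongrightarrow> xhat $ j * ln (xhat $ j / xhat $ j) - xhat $ j + xhat $ j"
    \<comment> \<open>At a zero component the quotient tends to no usable limit for
      \<open>ln\<close>, but its coefficient is 0.\<close>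
    proof (cases "xhat $ j = 0")
      case True
      then show ?thesis using lim by simp
    next
      case False
      then show ?thesis by (intro tendsto_intros lim) auto
    qed
  qed
  moreover have "kl_loss xhat xhat = 0"
    unfolding kl_loss_def by (intro sum.neutral) auto
  ultimately show ?thesis using L LIMSEQ_unique by metis
qed

text \<open>The K-L distance dominates the squared difference of square roots in each
  component.\<close>

lemma x_tendsto: "x \<longlonglongrightarrow> xhat"
proof (rule vec_tendstoI)
  fix j
  have "(sqrt (xhat $ j) - sqrt (x k $ j))\<^sup>2 \<le> kl_loss xhat (x k)" for k
    using kl_term_ge[OF xhat_nonneg x_pos] kl_loss_ge_term[OF xhat_nonneg x_pos]
    by (rule order_trans)
  then have "(\<lambda>k. (sqrt (xhat $ j) - sqrt (x k $ j))\<^sup>2) \<longlonglongrightarrow> 0"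
    by (intro tendsto_sandwich[OF _ _ tendsto_const kl_xhat_tendsto]) auto
  then have "(\<lambda>k. sqrt ((sqrt (xhat $ j) - sqrt (x k $ j))\<^sup>2)) \<longlonglongrightarrow> sqrt 0"
    by (rule tendsto_real_sqrt)
  then have "(\<lambda>k. sqrt (xhat $ j) - sqrt (x k $ j)) \<longlonglongrightarrow> 0"
    by (simp add: tendsto_rabs_zero_iff)
  then have "(\<lambda>k. sqrt (xhat $ j) - (sqrt (xhat $ j) - sqrt (x k $ j))) \<longlonglongrightarrow> sqrt (xhat $ j) - 0"
    by (intro tendsto_intros)
  then have "(\<lambda>k. (sqrt (x k $ j))\<^sup>2) \<longlonglongrightarrow> (sqrt (xhat $ j))\<^sup>2"
    by (intro tendsto_power) simp
  then show "(\<lambda>k. x k $ j) \<longlonglongrightarrow> xhat $ j"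
    by (simp add: xhat_nonneg x_pos less_imp_le)
qed

text \<open>
  If \<open>f\<^sub>j(xhat) > 1\<close>, then \<open>xhat\<^sub>j = 0\<close>; but \<open>y\<^sub>j \<ge> x\<^sub>j / (1 + M)\<close> with \<open>M\<close> tending to \<open>0\<close>, so the
  positive sequence \<open>x\<^sub>j\<close> eventually increases.
\<close>

lemma f_xhat_le_1: "f xhat j \<le> 1"
proof (rule ccontr)
  assume "\<not> f xhat j \<le> 1"
  then have gt: "1 < f xhat j" by simp
  have "xhat $ j * f xhat j = xhat $ j"
    using arg_cong[OF em_op_xhat, of "\<lambda>u. u $ j"] by (simp add: em_op_def)
  then have xhat0: "xhat $ j = 0" using gt by simp
  have "y \<longlonglongrightarrow> xhat"
    using tendsto_add[OF y_minus_x_tendsto x_tendsto] by simp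
  then have "(\<lambda>k. f (y k) j - (1 + M k)) \<longlonglongrightarrow> f xhat j - (1 + 0)"
    by (intro tendsto_intros tendsto_f M_tendsto d_xhat_pos)
  then have "\<forall>\<^sub>F k in sequentially. 0 < f (y k) j - (1 + M k)"
    using gt by (intro order_tendstoD) auto
  then obtain N where N: "\<And>k. N \<le> k \<Longrightarrow> 1 + M k < f (y k) j"
    by (auto simp: eventually_sequentially)
  have step: "x k $ j \<le> x (Suc k) $ j" if "N \<le> k" for k
  proof -
    have "\<beta> k * - (v k $ j / y k $ j) \<le> M k"
      by (intro mult_left_mono max_neg_ratio_ge y_pos less_imp_le \<beta>_pos)
    then have "y k $ j * (\<beta> k * - (v k $ j / y k $ j)) \<le> y k $ j * M k"
      by (rule mult_left_mono) (simp add: y_pos less_imp_le)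
    moreover have "y k $ j * (\<beta> k * - (v k $ j / y k $ j)) = - (\<beta> k * v k $ j)"
      using y_pos[of k j] by simp
    ultimately have "x k $ j \<le> y k $ j * (1 + M k)"
      using y_nth[of k j] by (simp only: distrib_left mult_1_right)
    also have "\<dots> \<le> x (Suc k) $ j"
      unfolding x_Suc using N[OF that] by (intro mult_left_mono less_imp_le y_pos) auto
    finally show ?thesis .
  qed
  have "x N $ j \<le> x (N + k) $ j" for k
    by (induction k) (use step in \<open>auto intro: order_trans\<close>)
  moreover have "(\<lambda>k. x (N + k) $ j) \<longlonglongrightarrow> xhat $ j"
    using LIMSEQ_ignore_initial_segment[OF tendsto_vec_nth[OF x_tendsto, of j], of N]
    by (simp add: add.commute)
  ultimately have "x N $ j \<le> xhat $ j"
    by (intro LIMSEQ_le_const) auto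
  then show False using x_pos[of N j] xhat0 by simp
qed

text \<open>
  The strictness of the decreasing condition excludes iterates that are unperturbed fixed points,
  for which both of its sides vanish.
\<close>

lemma not_stationary: "\<not> (em_fixpoint A b (x k) \<and> \<beta> k *\<^sub>R v k = 0)"
proof
  assume *: "em_fixpoint A b (x k) \<and> \<beta> k *\<^sub>R v k = 0"
  then have "x (Suc k) = x k" by (auto simp: iteration y_def em_fixpoint_def)
  then show False using J_less[of k] by simp
qed

end

theorem theorem2p3:
  fixes A :: "real ^ 'n ^ 'm" and b :: "real ^ 'm"
    and x y v :: "nat \<Rightarrow> real ^ 'n" and \<beta> :: "nat \<Rightarrow> real"
  assumes A_nonneg: "\<And>i j. 0 \<le> A $ i $ j"
    and A_col_sum: "\<And>j. (\<Sum>i\<in>UNIV. A $ i $ j) = 1"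
    and A_row_nonzero: "\<And>i. \<exists>j. A $ i $ j \<noteq> 0"
    and b_pos: "\<And>i. 0 < b $ i"
    and x0_pos: "\<And>j. 0 < x 0 $ j"
    and \<beta>_pos: "\<And>k. 0 < \<beta> k"
    and v_bounded: "bounded (range v)"
    and y_def: "\<And>k. y k = x k + \<beta> k *\<^sub>R v k"
    and iteration: "\<And>k. x (Suc k) = em_op A b (y k)"
    and positivity: "\<And>k j. 0 < y k $ j"
    and vanishing: "\<beta> \<longlonglongrightarrow> 0"
  shows "(\<exists>l r. strict_mono r \<and> (x \<circ> r) \<longlonglongrightarrow> l) \<and>
    (\<forall>\<rho> xhat.
      0 < \<rho> \<and>
      (\<exists>m. strict_mono m \<and> (x \<circ> m) \<longlonglongrightarrow> xhat) \<and>
      (\<forall>k. ereal (\<beta> k * max_neg_ratio (v k) (y k) * B_minus \<rho> (v k) (x (Suc k)) xhat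
                 - \<beta> k * min_pos_ratio (v k) (y k) * B_plus (v k) (x (Suc k)) xhat
                 + \<beta> k * (\<Sum>j\<in>UNIV. v k $ j))
            < kl_data A b (y k) - kl_data A b (x (Suc k)))
      \<longrightarrow>
      (\<forall>k. kl_data A b (x (Suc k)) \<le> kl_data A b (x k)) \<and>
      em_fixpoint A b xhat \<and>
      (\<forall>k. kl_dist xhat (x (Suc k)) \<le> kl_dist xhat (x k)) \<and>
      x \<longlonglongrightarrow> xhat \<and>
      (xhat \<in> nonneg_orthant \<and> (\<forall>z\<in>nonneg_orthant. kl_data A b xhat \<le> kl_data A b z)) \<and>
      (\<forall>k. kl_data A b (x (Suc k)) = kl_data A b (x k) \<longleftrightarrow>
            em_fixpoint A b (x k) \<and> \<beta> k *\<^sub>R v k = 0) \<and>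
      (\<forall>k. kl_dist xhat (x (Suc k)) = kl_dist xhat (x k) \<longleftrightarrow>
            em_fixpoint A b (x k) \<and> \<beta> k *\<^sub>R v k = 0))"
proof -
  interpret perturbed_em A b x y v \<beta>
    by standard (fact assms)+
  show ?thesis
  proof (rule conjI, rule convergent_subsequence, intro allI impI)
    fix \<rho> xhat
    assume H: "0 < \<rho> \<and>
      (\<exists>m. strict_mono m \<and> (x \<circ> m) \<longlonglongrightarrow> xhat) \<and>
      (\<forall>k. ereal (\<beta> k * max_neg_ratio (v k) (y k) * B_minus \<rho> (v k) (x (Suc k)) xhat
                 - \<beta> k * min_pos_ratio (v k) (y k) * B_plus (v k) (x (Suc k)) xhat
                 + \<beta> k * (\<Sum>j\<in>UNIV. v k $ j))
            < kl_data A b (y k) - kl_data A b (x (Suc k)))"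
    then obtain m where "strict_mono m" "(x \<circ> m) \<longlonglongrightarrow> xhat" by blast
    \<comment> \<open>Positivity makes all losses finite, so the extended-real condition becomes the
      real one.\<close>
    then interpret perturbed_em_decreasing A b x y v \<beta> \<rho> xhat m
      using H by unfold_locales (auto simp: kl_data_eq d_x_pos d_y_pos)
    note finite_values = kl_data_eq[OF d_x_pos] kl_dist_eq_kl_loss[OF x_pos]
    show "(\<forall>k. kl_data A b (x (Suc k)) \<le> kl_data A b (x k)) \<and>
      em_fixpoint A b xhat \<and>
      (\<forall>k. kl_dist xhat (x (Suc k)) \<le> kl_dist xhat (x k)) \<and>
      x \<longlonglongrightarrow> xhat \<and>
      (xhat \<in> nonneg_orthant \<and> (\<forall>z\<in>nonneg_orthant. kl_data A b xhat \<le> kl_data A b z)) \<and>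
      (\<forall>k. kl_data A b (x (Suc k)) = kl_data A b (x k) \<longleftrightarrow>
            em_fixpoint A b (x k) \<and> \<beta> k *\<^sub>R v k = 0) \<and>
      (\<forall>k. kl_dist xhat (x (Suc k)) = kl_dist xhat (x k) \<longleftrightarrow>
            em_fixpoint A b (x k) \<and> \<beta> k *\<^sub>R v k = 0)"
      \<comment> \<open>Both equivalences hold because both sides are false: the decrease is strict
        and no iterate is stationary.\<close>
      using J_less kl_xhat_less fixpoint_xhat x_tendsto not_stationary
        fixpoint_minimizer[OF fixpoint_xhat f_xhat_le_1]
      by (auto simp: finite_values less_imp_le less_imp_neq em_fixpoint_def)
  qed
qed

end
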